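(* Assume that $u$ is smooth enough in the stencil $S_2=[x_0,x_0+3h]$. Let the optimal weights be $c_0=K_0h^{\gamma_0}$, $c_1=K_1h^{\gamma_1}$, $c_2=1-K_0h^{\gamma_0}-K_1h^{\gamma_1}$ with $K_0,K_1\in\mathbb{R}_{>0}$ and $\gamma_0,\gamma_1\in\mathbb{R}_{\ge0}$, where $\gamma_0\ge\gamma_1$ and $\gamma_0\ge1$. Let $p\in\mathbb{N}$ and $q\le2$ in the definition of the weights $$\omega_i=\frac{\alpha_i}{\alpha_0+\alpha_1+\alpha_2},\qquad \alpha_i=\frac{c_i}{(\epsilon(h)+IS_i)^p},\qquad \epsilon(h)=Kh^q.$$ Then, as $h\to0$, $$\omega_0=c_0+O(h^{\gamma_0+2-q}),\qquad \omega_1=c_1+O(h^{\gamma_1+3-q}),\qquad \omega_2=c_2+O(h^{l+2-q}),$$ where $l=\min\{\gamma_0,\gamma_1+1\}$. In particular, if $\gamma_0\ge q$, then $$\omega_0=c_0+O(h^2),\qquad \omega_1=c_1+O(h),\qquad \omega_2=c_2+O(h).$$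
   Context: Grid: $h>0$ is the mesh size, $x_0\in\mathbb{R}$ the (fixed) left boundary point, $x_j=x_0+jh$, and for $j\in\{0.5,1.5,2.5\}$ the cells are $I_j=[x_j-\tfrac h2,x_j+\tfrac h2]$; $S_2=I_{0.5}\cup I_{1.5}\cup I_{2.5}$. Cell averages: $\bar u_j=\frac1h\int_{I_j}u(x)\,dx$; $\sigma_l=\bar u_{1.5}-\bar u_{0.5}$, $\sigma_r=\bar u_{2.5}-\bar u_{1.5}$. Smoothness indicators: $$IS_0=0,\qquad IS_1=\sigma_l^2,\qquad IS_2=\frac1{c_2^2}\Big(\tfrac43\sigma_r^2+\big(c_1-\tfrac{11}3\big)\sigma_r\sigma_l+\big(\tfrac{10}3-3c_1+c_1^2\big)\sigma_l^2\Big).$$ Parameters: $K\in\mathbb{R}_{>0}$ and $q\in\mathbb{R}_{>0}$ are fixed; $p\in\mathbb{N}$ means $p\ge1$; the weights satisfy $c_i>0$ for all sufficiently small $h$ and sum to $1$. Asymptotics: all $O(\cdot)$ are for $h\to0$ with $u$ and all parameters $K,K_0,K_1,\gamma_0,\gamma_1,p,q$ fixed. "Smooth enough" means $C^k$ with $k$ sufficiently large on $S_2$ for all sufficiently small $h$ (i.e. on $[x_0,x_0+3h_0]$ for some $h_0>0$). *)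

theory Defs
  imports "HOL-Analysis.Analysis" "HOL-Library.Landau_Symbols"
begin

text \<open>
  Class \<open>C\<^sup>k\<close> on a set \<open>S\<close>: \<open>D m\<close> is the \<open>m\<close>-th derivative. Derivatives are taken within \<open>S\<close>,
  so they are one-sided at the end points of a compact interval, and \<open>f\<close> is unconstrained
  outside \<open>S\<close>.
\<close>
definition Ck_on :: "nat \<Rightarrow> (real \<Rightarrow> real) \<Rightarrow> real set \<Rightarrow> bool" where
  "Ck_on k f S \<longleftrightarrow>
     (\<exists>D :: nat \<Rightarrow> real \<Rightarrow> real.
        (\<forall>x\<in>S. D 0 x = f x) \<and>
        (\<forall>m<k. \<forall>x\<in>S. (D m has_real_derivative D (Suc m) x) (at x within S)) \<and>
        continuous_on S (D k))"

definition grid_pt :: "real \<Rightarrow> real \<Rightarrow> real \<Rightarrow> real" where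
  "grid_pt x0 h j = x0 + j * h"

definition cell :: "real \<Rightarrow> real \<Rightarrow> real \<Rightarrow> real set" where
  "cell x0 h j = {grid_pt x0 h j - h / 2 .. grid_pt x0 h j + h / 2}"

definition cell_avg :: "(real \<Rightarrow> real) \<Rightarrow> real \<Rightarrow> real \<Rightarrow> real \<Rightarrow> real" where
  "cell_avg u x0 h j = (1 / h) * integral (cell x0 h j) u"

definition sigma_l :: "(real \<Rightarrow> real) \<Rightarrow> real \<Rightarrow> real \<Rightarrow> real" where
  "sigma_l u x0 h = cell_avg u x0 h (3/2) - cell_avg u x0 h (1/2)"

definition sigma_r :: "(real \<Rightarrow> real) \<Rightarrow> real \<Rightarrow> real \<Rightarrow> real" where
  "sigma_r u x0 h = cell_avg u x0 h (5/2) - cell_avg u x0 h (3/2)"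

text \<open>
  Families indexed by \<open>{0, 1, 2}\<close> are functions on \<open>nat\<close>; only the indices 0, 1, 2 are meaningful.
  In the definitions below, \<open>c\<close> is the family of optimal weights at the given mesh size \<open>h\<close>.
\<close>
definition IS :: "(real \<Rightarrow> real) \<Rightarrow> real \<Rightarrow> real \<Rightarrow> (nat \<Rightarrow> real) \<Rightarrow> nat \<Rightarrow> real" where
  "IS u x0 h c i =
     (let sl = sigma_l u x0 h; sr = sigma_r u x0 h in
      if i = 0 then 0
      else if i = 1 then sl\<^sup>2
      else 1 / (c 2)\<^sup>2 *
        (4/3 * sr\<^sup>2 + (c 1 - 11/3) * sr * sl + (10/3 - 3 * c 1 + (c 1)\<^sup>2) * sl\<^sup>2))"

definition opt_weight :: "real \<Rightarrow> real \<Rightarrow> real \<Rightarrow> real \<Rightarrow> real \<Rightarrow> nat \<Rightarrow> real" where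
  "opt_weight K0 K1 \<gamma>0 \<gamma>1 h i =
     (if i = 0 then K0 * h powr \<gamma>0
      else if i = 1 then K1 * h powr \<gamma>1
      else 1 - K0 * h powr \<gamma>0 - K1 * h powr \<gamma>1)"

definition alpha ::
    "(real \<Rightarrow> real) \<Rightarrow> real \<Rightarrow> real \<Rightarrow> real \<Rightarrow> nat \<Rightarrow> real \<Rightarrow> (nat \<Rightarrow> real) \<Rightarrow> nat \<Rightarrow> real" where
  "alpha u x0 K q p h c i = c i / (K * h powr q + IS u x0 h c i) ^ p"

definition omega ::
    "(real \<Rightarrow> real) \<Rightarrow> real \<Rightarrow> real \<Rightarrow> real \<Rightarrow> nat \<Rightarrow> real \<Rightarrow> (nat \<Rightarrow> real) \<Rightarrow> nat \<Rightarrow> real" where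
  "omega u x0 K q p h c i =
     alpha u x0 K q p h c i /
     (alpha u x0 K q p h c 0 + alpha u x0 K q p h c 1 + alpha u x0 K q p h c 2)"

end

theory Submission
  imports Defs
begin

text \<open>
  Write \<open>d\<^sub>i = \<epsilon>(h) + IS\<^sub>i\<close>, so that \<open>\<alpha>\<^sub>i = c\<^sub>i / d\<^sub>i\<^sup>p\<close>. If all \<open>d\<^sub>i\<close> were equal, the optimal weights, which
  sum to 1, would be reproduced exactly. Hence the error \<open>\<omega>\<^sub>i - c\<^sub>i\<close> is controlled by the
  differences \<open>d\<^sub>i - d\<^sub>j = IS\<^sub>i - IS\<^sub>j\<close>, relative to the size of the \<open>d\<^sub>j\<close>. Every smoothness
  indicator is nonnegative and \<open>O(h\<^sup>2)\<close>, and \<open>q \<le> 2\<close>, so all \<open>d\<^sub>j\<close> lie between \<open>\<epsilon>(h)\<close> and a fixed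
  multiple of it. Bounding powers of the ratios \<open>d\<^sub>i / d\<^sub>j\<close> then gives \<open>\<omega>\<^sub>i - c\<^sub>i = O(c\<^sub>i \<Sum>\<^sub>j c\<^sub>j |IS\<^sub>i - IS\<^sub>j| h\<^bsup>-q\<^esup>)\<close>
  (\<open>normalised_weight_error\<close> for fixed \<open>h\<close>, \<open>omega_error_bigo\<close> as \<open>h \<rightarrow> 0\<close>).

  Keeping the factors \<open>c\<^sub>j\<close> in this sum is what makes the three rates come out right. Since
  \<open>IS\<^sub>0 = 0\<close>, the pairs involving the index 0 only give \<open>O(h\<^sup>2)\<close>, but \<open>IS\<^sub>1\<close> and \<open>IS\<^sub>2\<close> agree up
  to \<open>O(h\<^sup>3)\<close>: for \<open>\<sigma>\<^sub>r = \<sigma>\<^sub>l\<close> the quadratic form in \<open>IS\<^sub>2\<close> collapses to \<open>(1 - c\<^sub>1)\<^sup>2 \<sigma>\<^sub>l\<^sup>2\<close>, which is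
  \<open>c\<^sub>2\<^sup>2 \<sigma>\<^sub>l\<^sup>2\<close> up to a multiple of \<open>c\<^sub>0 = O(h)\<close>, and \<open>\<sigma>\<^sub>r - \<sigma>\<^sub>l = O(h\<^sup>2)\<close> while
  \<open>\<sigma>\<^sub>l = O(h)\<close> (\<open>IS_2_minus_IS_1_bigo\<close>). Thus \<open>\<omega>\<^sub>0\<close> has the relative error \<open>O(h\<^bsup>2-q\<^esup>)\<close>; in the error of
  \<open>\<omega>\<^sub>1\<close> the pair with index 0 carries the factor \<open>c\<^sub>0 = O(h)\<close> (here \<open>\<gamma>\<^sub>0 \<ge> 1\<close>), so both pairs give
  \<open>O(h\<^bsup>3-q\<^esup>)\<close>; and \<open>\<omega>\<^sub>2\<close> picks up \<open>c\<^sub>0 h\<^bsup>2-q\<^esup> + c\<^sub>1 h\<^bsup>3-q\<^esup>\<close>, whence the minimum in \<open>l\<close>.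

  These orders of \<open>\<sigma>\<^sub>l\<close> and \<open>\<sigma>\<^sub>r - \<sigma>\<^sub>l\<close> are all that is used about \<open>u\<close>, so \<open>k = 2\<close> suffices.
\<close>

section \<open>Perturbation of normalised weights\<close>

lemma abs_one_minus_power_le:
  fixes r Q :: real
  assumes "0 \<le> r" "r \<le> Q" "1 \<le> Q"
  shows "\<bar>1 - r ^ p\<bar> \<le> real p * Q ^ p * \<bar>1 - r\<bar>"
proof -
  have "r ^ k \<le> Q ^ p" if "k < p" for k
  proof -
    have "r ^ k \<le> Q ^ k" using assms by (intro power_mono) auto
    also have "\<dots> \<le> Q ^ p" using assms that by (intro power_increasing) auto
    finally show ?thesis .
  qed
  then have "(\<Sum>k<p. r ^ k) \<le> real p * Q ^ p"
    using sum_bounded_above[of "{..<p}" "\<lambda>k. r ^ k" "Q ^ p"] by simp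
  moreover have "0 \<le> (\<Sum>k<p. r ^ k)" using assms by (intro sum_nonneg) auto
  moreover have "1 - r ^ p = (1 - r) * (\<Sum>k<p. r ^ k)" by (rule one_diff_power_eq)
  ultimately show ?thesis
    by (simp add: abs_mult mult.commute mult_left_mono)
qed

text \<open>
  With \<open>s = \<Sum>\<^sub>j c\<^sub>j (d\<^sub>i / d\<^sub>j)\<^sup>p\<close> the normalised weight is \<open>c\<^sub>i / s\<close>, and \<open>\<Sum>\<^sub>j c\<^sub>j = 1\<close> turns its error
  into \<open>(c\<^sub>i / s) \<Sum>\<^sub>j c\<^sub>j (1 - (d\<^sub>i / d\<^sub>j)\<^sup>p)\<close>. All ratios of the \<open>d\<^sub>j\<close> lie in \<open>[1/Q, Q]\<close>, which bounds
  \<open>s\<close> from below and each summand by a multiple of \<open>|d\<^sub>i - d\<^sub>j| / e\<close>.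
\<close>
lemma normalised_weight_error:
  fixes c d w :: "'i \<Rightarrow> real"
  assumes fin: "finite I" and i: "i \<in> I"
    and c: "\<And>j. j \<in> I \<Longrightarrow> 0 < c j" and sum_c: "sum c I = 1"
    and e: "0 < e" and lower: "\<And>j. j \<in> I \<Longrightarrow> e \<le> d j" and upper: "\<And>j. j \<in> I \<Longrightarrow> d j \<le> Q * e"
    and w: "\<And>j. j \<in> I \<Longrightarrow> w j = c j / d j ^ p"
  shows "\<bar>w i / sum w I - c i\<bar> \<le> real p * Q ^ (2 * p) * (c i * (\<Sum>j\<in>I. c j * \<bar>d i - d j\<bar>) / e)"
proof -
  define s where "s = (\<Sum>j\<in>I. c j * (d i / d j) ^ p)"
  have d: "0 < d j" if "j \<in> I" for j using lower[OF that] e by linarith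
  have "1 * e \<le> Q * e" using lower[OF i] upper[OF i] by simp
  then have Q: "1 \<le> Q" using e by simp
  have ratio: "0 \<le> d j / d k" "d j / d k \<le> Q" if "j \<in> I" "k \<in> I" for j k
  proof -
    show "0 \<le> d j / d k" using d that by (simp add: less_imp_le)
    have "Q * e \<le> Q * d k" using lower[OF that(2)] Q by (simp add: mult_left_mono)
    then have "d j \<le> Q * d k" using upper[OF that(1)] by linarith
    then show "d j / d k \<le> Q" using d[OF that(2)] by (simp add: pos_divide_le_eq)
  qed
  have s_lower: "1 \<le> Q ^ p * s"
  proof -
    have "c j \<le> Q ^ p * (c j * (d i / d j) ^ p)" if j: "j \<in> I" for j
    proof -
      have "(d j / d i) ^ p \<le> Q ^ p" using ratio[OF j i] by (intro power_mono) auto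
      then have "(d j / d i) ^ p * (d i / d j) ^ p \<le> Q ^ p * (d i / d j) ^ p"
        using ratio[OF i j] by (intro mult_right_mono) auto
      moreover have "(d j / d i) ^ p * (d i / d j) ^ p = 1"
        using d[OF i] d[OF j] by (simp flip: power_mult_distrib)
      ultimately have "c j * 1 \<le> c j * (Q ^ p * (d i / d j) ^ p)"
        using c[OF j] by (intro mult_left_mono) auto
      then show ?thesis by (simp add: mult_ac)
    qed
    then have "sum c I \<le> Q ^ p * s"
      unfolding s_def sum_distrib_left by (intro sum_mono) auto
    then show ?thesis using sum_c by simp
  qed
  have s_pos: "0 < s"
    using c d i fin unfolding s_def by (intro sum_pos) auto
  have "w i / sum w I = c i / s"
  proof -
    have "s = sum w I * d i ^ p"
      unfolding s_def sum_distrib_right by (intro sum.cong) (auto simp: w power_divide)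
    then show ?thesis using d[OF i] s_pos by (simp add: w[OF i] field_simps)
  qed
  then have "w i / sum w I - c i = c i / s * (1 - s)"
    using s_pos by (simp add: field_simps)
  also have "1 - s = (\<Sum>j\<in>I. c j * (1 - (d i / d j) ^ p))"
    unfolding s_def by (simp add: right_diff_distrib sum_subtractf sum_c)
  finally have "\<bar>w i / sum w I - c i\<bar> = c i / s * \<bar>\<Sum>j\<in>I. c j * (1 - (d i / d j) ^ p)\<bar>"
    using c[OF i] s_pos by (simp add: abs_mult)
  also have "\<dots> \<le> c i * Q ^ p * (\<Sum>j\<in>I. c j * (real p * Q ^ p * (\<bar>d i - d j\<bar> / e)))"
  proof (intro mult_mono)
    have "1 / s \<le> Q ^ p" using s_lower s_pos by (simp add: pos_divide_le_eq)
    then have "c i * (1 / s) \<le> c i * Q ^ p" using c[OF i] by (intro mult_left_mono) auto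
    then show "c i / s \<le> c i * Q ^ p" by simp
    show "\<bar>\<Sum>j\<in>I. c j * (1 - (d i / d j) ^ p)\<bar>
        \<le> (\<Sum>j\<in>I. c j * (real p * Q ^ p * (\<bar>d i - d j\<bar> / e)))"
    proof (intro order_trans[OF sum_abs] sum_mono)
      fix j assume j: "j \<in> I"
      have "1 - d i / d j = (d j - d i) / d j"
        using d[OF j] by (simp add: diff_divide_distrib)
      then have "\<bar>1 - d i / d j\<bar> = \<bar>d i - d j\<bar> / d j"
        using d[OF j] by (simp only: abs_divide) (simp add: abs_minus_commute)
      also have "\<dots> \<le> \<bar>d i - d j\<bar> / e"
        using lower[OF j] e by (intro divide_left_mono) auto
      finally have "real p * Q ^ p * \<bar>1 - d i / d j\<bar> \<le> real p * Q ^ p * (\<bar>d i - d j\<bar> / e)"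
        using Q by (intro mult_left_mono) auto
      then have "\<bar>1 - (d i / d j) ^ p\<bar> \<le> real p * Q ^ p * (\<bar>d i - d j\<bar> / e)"
        using abs_one_minus_power_le[OF ratio[OF i j] Q, of p] by linarith
      then show "\<bar>c j * (1 - (d i / d j) ^ p)\<bar> \<le> c j * (real p * Q ^ p * (\<bar>d i - d j\<bar> / e))"
        using c[OF j] by (simp only: abs_mult) (intro mult_mono, auto)
    qed
  qed (use c[OF i] Q in auto)
  also have "\<dots> = real p * Q ^ (2 * p) * (c i * (\<Sum>j\<in>I. c j * \<bar>d i - d j\<bar>) / e)"
    unfolding mult_2 power_add by (simp add: sum_distrib_left sum_divide_distrib mult_ac)
  finally show ?thesis .
qed

section \<open>Differences of cell averages\<close>

text \<open>
  Two applications of the mean value inequality, first to \<open>u'\<close> and then to \<open>u\<close> minus its tangent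
  at \<open>a\<close>. This loses the factor 1/2 of the sharp remainder.
\<close>
lemma Ck_2_taylor_bound:
  assumes "Ck_on 2 u {a..b}"
  shows "continuous_on {a..b} u"
    and "\<exists>s M. 0 \<le> M \<and> (\<forall>x\<in>{a..b}. \<bar>u x - u a - s * (x - a)\<bar> \<le> M * (x - a)\<^sup>2)"
proof -
  obtain D :: "nat \<Rightarrow> real \<Rightarrow> real" where D0: "\<And>x. x \<in> {a..b} \<Longrightarrow> D 0 x = u x"
    and D': "\<And>m x. m < 2 \<Longrightarrow> x \<in> {a..b} \<Longrightarrow> (D m has_real_derivative D (Suc m) x) (at x within {a..b})"
    and D2: "continuous_on {a..b} (D 2)"
    using assms unfolding Ck_on_def by blast
  have "bounded (D 2 ` {a..b})"
    using D2 by (intro compact_imp_bounded compact_continuous_image) auto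
  then obtain M where M: "0 < M" "\<And>x. x \<in> {a..b} \<Longrightarrow> \<bar>D 2 x\<bar> \<le> M"
    unfolding bounded_pos by auto
  have slope: "\<bar>D 1 x - D 1 a\<bar> \<le> M * (x - a)" if x: "x \<in> {a..b}" for x
  proof -
    have "norm (D 1 x - D 1 a) \<le> M * norm (x - a)"
    proof (rule field_differentiable_bound[of "{a..b}" "D 1" "D 2"])
      show "(D 1 has_field_derivative D 2 z) (at z within {a..b})" if "z \<in> {a..b}" for z
        using D'[of 1 z] that by (simp add: numeral_2_eq_2)
    qed (use x M in auto)
    then show ?thesis using x by simp
  qed
  have taylor: "\<bar>u x - u a - D 1 a * (x - a)\<bar> \<le> M * (x - a)\<^sup>2" if x: "x \<in> {a..b}" for x
  proof -
    let ?g = "\<lambda>z. D 0 z - D 1 a * z"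
    have "norm (?g x - ?g a) \<le> M * (x - a) * norm (x - a)"
    proof (rule field_differentiable_bound[of "{a..x}" ?g "\<lambda>z. D 1 z - D 1 a"])
      show "(?g has_field_derivative D 1 z - D 1 a) (at z within {a..x})" if "z \<in> {a..x}" for z
      proof -
        have "(D 0 has_field_derivative D 1 z) (at z within {a..x})"
          using D'[of 0 z] that x by (auto intro: DERIV_subset)
        then show ?thesis by (auto intro!: derivative_eq_intros)
      qed
      show "norm (D 1 z - D 1 a) \<le> M * (x - a)" if z: "z \<in> {a..x}" for z
      proof -
        have "M * (z - a) \<le> M * (x - a)" using z M by simp
        then show ?thesis using slope[of z] z x by auto
      qed
    qed (use x in auto)
    then show ?thesis using x D0[of x] D0[of a] by (simp add: power2_eq_square algebra_simps)
  qed
  have "continuous_on {a..b} (D 0)"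
    using D'[of 0] by (intro DERIV_continuous_on) auto
  then show "continuous_on {a..b} u" by (rule continuous_on_eq) (rule D0)
  show "\<exists>s M. 0 \<le> M \<and> (\<forall>x\<in>{a..b}. \<bar>u x - u a - s * (x - a)\<bar> \<le> M * (x - a)\<^sup>2)"
    using M(1) taylor by (intro exI[of _ "D 1 a"] exI[of _ M]) auto
qed

text \<open>
  The average of an affine function over a cell is its value at the midpoint, and averaging does
  not increase the sup norm of the remainder.
\<close>
lemma cell_avg_taylor:
  assumes h: "0 < h" and j: "1/2 \<le> j" and cont: "continuous_on {x0..x0 + (j + 1/2) * h} u"
    and taylor: "\<And>x. x \<in> {x0..x0 + (j + 1/2) * h} \<Longrightarrow> \<bar>u x - v - s * (x - x0)\<bar> \<le> M * (x - x0)\<^sup>2"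
    and M: "0 \<le> M"
  shows "\<bar>cell_avg u x0 h j - (v + s * j * h)\<bar> \<le> M * ((j + 1/2) * h)\<^sup>2"
proof -
  define a b where "a = x0 + (j - 1/2) * h" and "b = x0 + (j + 1/2) * h"
  have cell: "cell x0 h j = {a..b}"
    by (simp add: cell_def grid_pt_def a_def b_def algebra_simps)
  have ab: "x0 \<le> a" "a \<le> b" "b - a = h"
    using h j by (auto simp: a_def b_def algebra_simps)
  have "u integrable_on {a..b}"
    using ab by (intro integrable_continuous_real continuous_on_subset[OF cont]) (auto simp: b_def)
  then have u: "(u has_integral integral {a..b} u) {a..b}" by (rule integrable_integral)
  have "((\<lambda>x. v + s * (x - x0)) has_integral
      (v * b + s * (b - x0)\<^sup>2 / 2) - (v * a + s * (a - x0)\<^sup>2 / 2)) {a..b}"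
    using ab by (intro fundamental_theorem_of_calculus)
      (auto intro!: derivative_eq_intros simp flip: has_real_derivative_iff_has_vector_derivative)
  moreover have "(v * b + s * (b - x0)\<^sup>2 / 2) - (v * a + s * (a - x0)\<^sup>2 / 2) = h * (v + s * j * h)"
    by (simp add: a_def b_def power2_eq_square field_simps)
  ultimately have "((\<lambda>x. v + s * (x - x0)) has_integral h * (v + s * j * h)) {a..b}" by simp
  from has_integral_diff[OF u this]
  have diff: "((\<lambda>x. u x - (v + s * (x - x0))) has_integral integral {a..b} u - h * (v + s * j * h)) {a..b}" .
  have "norm (integral {a..b} u - h * (v + s * j * h)) \<le> M * ((j + 1/2) * h)\<^sup>2 * measure lborel {a..b}"
  proof (rule has_integral_bound_real[OF _ finite.emptyI diff])
    fix x assume "x \<in> {a..b} - {}"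
    then have x: "x \<in> {a..b}" by simp
    have "M * (x - x0)\<^sup>2 \<le> M * ((j + 1/2) * h)\<^sup>2"
      using M x ab by (intro mult_left_mono power_mono) (auto simp: b_def)
    then show "norm (u x - (v + s * (x - x0))) \<le> M * ((j + 1/2) * h)\<^sup>2"
      using taylor[of x] x ab by (auto simp: b_def algebra_simps)
  qed (use M in auto)
  then have "\<bar>integral {a..b} u - h * (v + s * j * h)\<bar> / h \<le> M * ((j + 1/2) * h)\<^sup>2"
    using ab h by (simp add: pos_divide_le_eq)
  moreover have "cell_avg u x0 h j - (v + s * j * h) = (integral {a..b} u - h * (v + s * j * h)) / h"
    using h by (simp add: cell_avg_def cell field_simps)
  ultimately show ?thesis using h by (simp only: abs_divide abs_of_pos)
qed

text \<open>
  All three cell averages are values of one affine function at equidistant points, up to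
  \<open>O(h\<^sup>2)\<close>; so both differences equal the same \<open>s h\<close> up to \<open>O(h\<^sup>2)\<close>.
\<close>
lemma sigma_asymptotics:
  assumes "0 < h0" "Ck_on 2 u {x0..x0 + 3 * h0}"
  shows sigma_l_bigo: "sigma_l u x0 \<in> O[at_right 0](\<lambda>h. h)"
    and sigma_diff_bigo: "(\<lambda>h. sigma_r u x0 h - sigma_l u x0 h) \<in> O[at_right 0](\<lambda>h. h\<^sup>2)"
proof -
  obtain s M where M: "0 \<le> M"
    and taylor: "\<forall>x\<in>{x0..x0 + 3 * h0}. \<bar>u x - u x0 - s * (x - x0)\<bar> \<le> M * (x - x0)\<^sup>2"
    using Ck_2_taylor_bound(2)[OF assms(2)] by auto
  have cont: "continuous_on {x0..x0 + 3 * h0} u" by (rule Ck_2_taylor_bound(1)[OF assms(2)])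
  have avg: "\<bar>cell_avg u x0 h j - (u x0 + s * j * h)\<bar> \<le> 9 * M * h\<^sup>2"
    if h: "0 < h" "h \<le> h0" and j: "1/2 \<le> j" "j \<le> 5/2" for h j
  proof -
    have "(j + 1/2) * h \<le> 3 * h0" using h j by (intro mult_mono) auto
    then have sub: "{x0..x0 + (j + 1/2) * h} \<subseteq> {x0..x0 + 3 * h0}" by auto
    have "\<bar>cell_avg u x0 h j - (u x0 + s * j * h)\<bar> \<le> M * ((j + 1/2) * h)\<^sup>2"
      using h j sub taylor M by (intro cell_avg_taylor continuous_on_subset[OF cont]) auto
    also have "\<dots> \<le> M * (3 * h)\<^sup>2"
      using h j M by (intro mult_left_mono power_mono mult_right_mono) auto
    finally show ?thesis by (simp add: power_mult_distrib)
  qed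
  have ev: "eventually (\<lambda>h. 0 < h \<and> h \<le> h0 \<and> h \<le> 1) (at_right 0)"
    unfolding eventually_at_right_field using assms(1) by (intro exI[of _ "min h0 1"]) auto
  show "sigma_l u x0 \<in> O[at_right 0](\<lambda>h. h)"
  proof (rule bigoI[of _ "\<bar>s\<bar> + 18 * M"], use ev in eventually_elim)
    case (elim h)
    have "\<bar>sigma_l u x0 h - s * h\<bar> \<le> 18 * M * h\<^sup>2"
      using avg[of h "1/2"] avg[of h "3/2"] elim by (simp add: sigma_l_def)
    moreover have "18 * M * h\<^sup>2 \<le> 18 * M * h"
      using elim M by (intro mult_left_mono) (auto simp: power2_eq_square mult_left_le)
    moreover have "\<bar>s * h\<bar> = \<bar>s\<bar> * h" using elim by (simp add: abs_mult)
    ultimately have "\<bar>sigma_l u x0 h\<bar> \<le> \<bar>s\<bar> * h + 18 * M * h" by linarith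
    then show ?case using elim by (simp add: algebra_simps)
  qed
  show "(\<lambda>h. sigma_r u x0 h - sigma_l u x0 h) \<in> O[at_right 0](\<lambda>h. h\<^sup>2)"
  proof (rule bigoI[of _ "36 * M"], use ev in eventually_elim)
    case (elim h)
    then show ?case
      using avg[of h "1/2"] avg[of h "3/2"] avg[of h "5/2"] by (simp add: sigma_l_def sigma_r_def)
  qed
qed

section \<open>Algebra of the smoothness indicators\<close>

text \<open>
  Completing the square in \<open>a\<close>: the discriminant of the form is \<open>- 13/3 (1 - t)\<^sup>2\<close>.
\<close>
lemma quadratic_form_nonneg:
  fixes a b t :: real
  shows "0 \<le> 4/3 * a\<^sup>2 + (t - 11/3) * a * b + (10/3 - 3 * t + t\<^sup>2) * b\<^sup>2"
proof -
  have "4/3 * a\<^sup>2 + (t - 11/3) * a * b + (10/3 - 3 * t + t\<^sup>2) * b\<^sup>2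
      = 4/3 * (a + 3/8 * (t - 11/3) * b)\<^sup>2 + 13/16 * ((1 - t) * b)\<^sup>2"
    by (simp add: power2_eq_square field_simps)
  then show ?thesis by (simp only:) simp
qed

lemma IS_nonneg: "0 \<le> IS u x0 h c i"
  using quadratic_form_nonneg[of "sigma_r u x0 h" "c 1" "sigma_l u x0 h"]
  by (simp add: IS_def Let_def)

text \<open>
  Expanding around \<open>\<sigma>\<^sub>r = \<sigma>\<^sub>l\<close>, the coefficient of \<open>\<sigma>\<^sub>l\<^sup>2\<close> in the form is \<open>(1 - c\<^sub>1)\<^sup>2\<close>, because
  \<open>4/3 - 11/3 + 10/3 = 1\<close>. Since \<open>1 - c\<^sub>1 = c\<^sub>0 + c\<^sub>2\<close>, subtracting \<open>c\<^sub>2\<^sup>2\<close> leaves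
  \<open>c\<^sub>0 (c\<^sub>0 + 2 c\<^sub>2)\<close>. Each of the three terms below is of third order in \<open>h\<close> as soon as \<open>c\<^sub>0\<close>
  and \<open>\<sigma>\<^sub>l\<close> are of first and \<open>\<delta>\<close> of second order.
\<close>
lemma IS_2_minus_IS_1:
  fixes u :: "real \<Rightarrow> real" and x0 h :: real and c :: "nat \<Rightarrow> real"
  assumes "c 0 + c 1 + c 2 = 1" "c 2 \<noteq> 0"
  defines "\<delta> \<equiv> sigma_r u x0 h - sigma_l u x0 h"
  shows "IS u x0 h c 2 - IS u x0 h c 1 = 1 / (c 2)\<^sup>2 *
    (4/3 * \<delta>\<^sup>2 + (c 1 - 1) * sigma_l u x0 h * \<delta> + c 0 * (c 0 + 2 * c 2) * (sigma_l u x0 h)\<^sup>2)"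
proof -
  have c1: "c 1 = 1 - c 0 - c 2" using assms by simp
  show ?thesis using assms(2) unfolding IS_def Let_def \<delta>_def c1
    by (simp add: field_simps power2_eq_square)
qed


section \<open>Powers near zero\<close>

lemma powr_bigo_powr_at_right_0:
  assumes "b \<le> a"
  shows "(\<lambda>h::real. h powr a) \<in> O[at_right 0](\<lambda>h. h powr b)"
proof (rule bigoI[of _ 1])
  show "\<forall>\<^sub>F h::real in at_right 0. norm (h powr a) \<le> 1 * norm (h powr b)"
    unfolding eventually_at_right_field using assms
    by (intro exI[of _ 1]) (auto intro: powr_mono')
qed

lemma bigo_powr_mult_at_right_0:
  assumes "f \<in> O[at_right 0](\<lambda>h::real. h powr a)" "g \<in> O[at_right 0](\<lambda>h. h powr b)"
  shows "(\<lambda>h. f h * g h) \<in> O[at_right 0](\<lambda>h. h powr (a + b))"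
  using landau_o.big.mult[OF assms] by (simp add: powr_add)

lemma id_bigtheta_powr_1: "(\<lambda>h::real. h) \<in> \<Theta>[at_right 0](\<lambda>h. h powr 1)"
  by (intro bigthetaI_cong eventually_mono[OF eventually_at_right_less[of 0]]) auto

lemma square_bigtheta_powr_2: "(\<lambda>h::real. h ^ 2) \<in> \<Theta>[at_right 0](\<lambda>h. h powr 2)"
  by (intro bigthetaI_cong eventually_mono[OF eventually_at_right_less[of 0]]) (auto simp: powr_numeral)

section \<open>Asymptotics of the weights\<close>

text \<open>
  \<open>c\<^sub>2\<close> has a limit, namely 1 or, if \<open>\<gamma>\<^sub>1 = 0\<close>, the number \<open>1 - K\<^sub>1\<close>. In the second case positivity of
  \<open>c\<^sub>2\<close> forces this limit to be strictly positive, since \<open>c\<^sub>2\<close> stays below it by the positive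
  amount \<open>K\<^sub>0 h\<^bsup>\<gamma>\<^sub>0\<^esup>\<close>.
\<close>
lemma opt_weight_2_bounded_below:
  assumes g: "1 \<le> \<gamma>0" "0 \<le> \<gamma>1" and K0: "0 < K0"
    and pos: "eventually (\<lambda>h. 0 < opt_weight K0 K1 \<gamma>0 \<gamma>1 h 2) (at_right 0)"
  obtains m where "0 < m" "eventually (\<lambda>h. m \<le> opt_weight K0 K1 \<gamma>0 \<gamma>1 h 2) (at_right 0)"
proof -
  have powr_0: "((\<lambda>h::real. h powr g) \<longlongrightarrow> 0) (at_right 0)" if "0 < g" for g
    using that by (auto intro!: tendsto_eq_intros intro: eventually_mono[OF eventually_at_right_less])
  have "\<exists>L>0. ((\<lambda>h. opt_weight K0 K1 \<gamma>0 \<gamma>1 h 2) \<longlongrightarrow> L) (at_right 0)"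
  proof (cases "\<gamma>1 = 0")
    case True
    have "eventually (\<lambda>h::real. 0 < h \<and> 0 < opt_weight K0 K1 \<gamma>0 \<gamma>1 h 2) (at_right 0)"
      using pos by (intro eventually_conj eventually_at_right_less)
    then obtain h :: real where "0 < h" "0 < opt_weight K0 K1 \<gamma>0 \<gamma>1 h 2"
      using eventually_happens[of _ "at_right (0::real)"] by (auto simp: trivial_limit_at_right_real)
    moreover have "0 < K0 * h powr \<gamma>0" using K0 \<open>0 < h\<close> by simp
    ultimately have K1: "K1 < 1" using True by (simp add: opt_weight_def)
    have "((\<lambda>h. 1 - K0 * h powr \<gamma>0 - K1) \<longlongrightarrow> 1 - K0 * 0 - K1) (at_right 0)"
      using g by (intro tendsto_intros powr_0) auto
    moreover have "eventually (\<lambda>h. 1 - K0 * h powr \<gamma>0 - K1 = opt_weight K0 K1 \<gamma>0 \<gamma>1 h 2) (at_right 0)"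
      using True by (intro eventually_mono[OF eventually_at_right_less[of 0]]) (auto simp: opt_weight_def)
    ultimately have "((\<lambda>h. opt_weight K0 K1 \<gamma>0 \<gamma>1 h 2) \<longlongrightarrow> 1 - K0 * 0 - K1) (at_right 0)"
      by (rule Lim_transform_eventually)
    then show ?thesis using K1 by (intro exI[of _ "1 - K1"]) auto
  next
    case False
    have "((\<lambda>h. 1 - K0 * h powr \<gamma>0 - K1 * h powr \<gamma>1) \<longlongrightarrow> 1 - K0 * 0 - K1 * 0) (at_right 0)"
      using g False by (intro tendsto_intros powr_0) auto
    then show ?thesis by (intro exI[of _ 1]) (auto simp: opt_weight_def)
  qed
  then obtain L where L: "0 < L" "((\<lambda>h. opt_weight K0 K1 \<gamma>0 \<gamma>1 h 2) \<longlongrightarrow> L) (at_right 0)" by auto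
  then have "eventually (\<lambda>h. L / 2 < opt_weight K0 K1 \<gamma>0 \<gamma>1 h 2) (at_right 0)"
    by (intro order_tendstoD) auto
  with L show thesis by (intro that[of "L / 2"]) (auto elim: eventually_mono)
qed

text \<open>
  The lower bound \<open>m\<close> on \<open>c\<^sub>2\<close> keeps the factor \<open>1 / c\<^sub>2\<^sup>2\<close> in \<open>IS\<^sub>2\<close> from spoiling the order.
\<close>
lemma IS_bigo:
  fixes c :: "real \<Rightarrow> nat \<Rightarrow> real"
  assumes sl: "sigma_l u x0 \<in> O[at_right 0](\<lambda>h. h)"
    and diff: "(\<lambda>h. sigma_r u x0 h - sigma_l u x0 h) \<in> O[at_right 0](\<lambda>h. h\<^sup>2)"
    and c0: "(\<lambda>h. c h 0) \<in> O[at_right 0](\<lambda>h. h)"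
    and c: "eventually (\<lambda>h. (\<forall>i<3. 0 < c h i) \<and> c h 0 + c h 1 + c h 2 = 1) (at_right 0)"
    and m: "0 < m" "eventually (\<lambda>h. m \<le> c h 2) (at_right 0)"
  shows IS_1_bigo: "(\<lambda>h. IS u x0 h (c h) 1) \<in> O[at_right 0](\<lambda>h. h\<^sup>2)"
    and IS_2_minus_IS_1_bigo:
      "(\<lambda>h. IS u x0 h (c h) 2 - IS u x0 h (c h) 1) \<in> O[at_right 0](\<lambda>h. h ^ 3)"
    and IS_2_bigo: "(\<lambda>h. IS u x0 h (c h) 2) \<in> O[at_right 0](\<lambda>h. h\<^sup>2)"
proof -
  let ?sl = "sigma_l u x0" and ?\<delta> = "\<lambda>h. sigma_r u x0 h - sigma_l u x0 h"
  show IS1: "(\<lambda>h. IS u x0 h (c h) 1) \<in> O[at_right 0](\<lambda>h. h\<^sup>2)"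
    using landau_o.big_power[OF sl, of 2] by (simp add: IS_def Let_def)
  have bounds: "eventually (\<lambda>h. \<bar>1 / (c h 2)\<^sup>2\<bar> \<le> 1 / m\<^sup>2 \<and> \<bar>c h 1 - 1\<bar> \<le> 1 \<and> \<bar>c h 0 + 2 * c h 2\<bar> \<le> 2)
      (at_right 0)"
    using c m(2)
  proof eventually_elim
    case (elim h)
    then have "0 < c h 0" "0 < c h 1" "0 < c h 2" "c h 0 + c h 1 + c h 2 = 1" by auto
    moreover have "1 / (c h 2)\<^sup>2 \<le> 1 / m\<^sup>2"
      using elim m(1) by (intro divide_left_mono power_mono) auto
    ultimately show ?case by auto
  qed
  have inv_c2: "(\<lambda>h. 1 / (c h 2)\<^sup>2) \<in> O[at_right 0](\<lambda>_. 1)"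
    by (rule bigoI[of _ "1 / m\<^sup>2"]) (use bounds in eventually_elim, auto)
  have c1: "(\<lambda>h. c h 1 - 1) \<in> O[at_right 0](\<lambda>_. 1)"
    by (rule bigoI[of _ 1]) (use bounds in eventually_elim, auto)
  have c02: "(\<lambda>h. c h 0 + 2 * c h 2) \<in> O[at_right 0](\<lambda>_. 1)"
    by (rule bigoI[of _ 2]) (use bounds in eventually_elim, auto)
  have higher: "(\<lambda>h::real. h ^ b) \<in> O[at_right 0](\<lambda>h. h ^ a)" if "a \<le> b" for a b
    by (rule bigoI[of _ 1], unfold eventually_at_right_field, intro exI[of _ 1])
      (use that in \<open>auto intro: power_decreasing\<close>)
  have A: "(\<lambda>h. 4/3 * (?\<delta> h)\<^sup>2) \<in> O[at_right 0](\<lambda>h. h ^ 3)"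
  proof -
    have "(\<lambda>h. (?\<delta> h)\<^sup>2) \<in> O[at_right 0](\<lambda>h. (h\<^sup>2)\<^sup>2)" by (rule landau_o.big_power[OF diff])
    also have "(\<lambda>h::real. (h\<^sup>2)\<^sup>2) \<in> O[at_right 0](\<lambda>h. h ^ 3)"
      using higher[of 3 4] by (simp flip: power_mult)
    finally show ?thesis by (subst landau_o.big.cmult_in_iff) auto
  qed
  have B: "(\<lambda>h. (c h 1 - 1) * ?sl h * ?\<delta> h) \<in> O[at_right 0](\<lambda>h. h ^ 3)"
    using landau_o.big.mult[OF landau_o.big.mult[OF c1 sl] diff]
    by (simp add: power2_eq_square power3_eq_cube mult.assoc)
  have C: "(\<lambda>h. c h 0 * (c h 0 + 2 * c h 2) * (?sl h)\<^sup>2) \<in> O[at_right 0](\<lambda>h. h ^ 3)"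
    using landau_o.big.mult[OF landau_o.big.mult[OF c0 c02] landau_o.big_power[OF sl, of 2]]
    by (simp add: power2_eq_square power3_eq_cube mult.assoc)
  have "(\<lambda>h. 1 / (c h 2)\<^sup>2 * (4/3 * (?\<delta> h)\<^sup>2 + (c h 1 - 1) * ?sl h * ?\<delta> h
      + c h 0 * (c h 0 + 2 * c h 2) * (?sl h)\<^sup>2)) \<in> O[at_right 0](\<lambda>h. h ^ 3)"
    using landau_o.big.mult[OF inv_c2 sum_in_bigo(1)[OF sum_in_bigo(1)[OF A B] C]] by simp
  also have "?this \<longleftrightarrow> (\<lambda>h. IS u x0 h (c h) 2 - IS u x0 h (c h) 1) \<in> O[at_right 0](\<lambda>h. h ^ 3)"
  proof (intro landau_o.big.in_cong, use c in eventually_elim)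
    case (elim h)
    then have "c h 0 + c h 1 + c h 2 = 1" "0 < c h 2" by auto
    then show ?case by (subst IS_2_minus_IS_1) auto
  qed
  finally show diff3: "(\<lambda>h. IS u x0 h (c h) 2 - IS u x0 h (c h) 1) \<in> O[at_right 0](\<lambda>h. h ^ 3)" .
  show "(\<lambda>h. IS u x0 h (c h) 2) \<in> O[at_right 0](\<lambda>h. h\<^sup>2)"
    using sum_in_bigo(1)[OF landau_o.big_trans[OF diff3 higher[of 2 3]] IS1] by simp
qed

text \<open>
  The hypothesis \<open>q \<le> 2\<close> enters here: \<open>IS\<^sub>j = O(h\<^sup>2)\<close> is then dominated by \<open>\<epsilon>(h) = K h\<^sup>q\<close>, so the
  constant \<open>Q\<close> of \<open>normalised_weight_error\<close> can be chosen independently of \<open>h\<close>.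
\<close>
lemma omega_error_bigo:
  fixes c :: "real \<Rightarrow> nat \<Rightarrow> real"
  assumes K: "0 < K" and q: "q \<le> 2" and i: "i < 3"
    and c: "eventually (\<lambda>h. (\<forall>i<3. 0 < c h i) \<and> c h 0 + c h 1 + c h 2 = 1) (at_right 0)"
    and IS: "\<And>j. j < 3 \<Longrightarrow> (\<lambda>h. IS u x0 h (c h) j) \<in> O[at_right 0](\<lambda>h. h\<^sup>2)"
  shows "(\<lambda>h. omega u x0 K q p h (c h) i - c h i)
    \<in> O[at_right 0](\<lambda>h. c h i * (\<Sum>j<3. c h j * \<bar>IS u x0 h (c h) i - IS u x0 h (c h) j\<bar>) * h powr (- q))"
proof -
  have "(\<lambda>h. \<Sum>j<3. IS u x0 h (c h) j) \<in> O[at_right 0](\<lambda>h. h\<^sup>2)"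
    using IS by (intro big_sum_in_bigo) auto
  then obtain B where B: "0 < B"
    "eventually (\<lambda>h. norm (\<Sum>j<3. IS u x0 h (c h) j) \<le> B * norm (h\<^sup>2)) (at_right 0)"
    by (elim landau_o.bigE)
  \<comment> \<open>\<open>K h\<^sup>q + IS\<^sub>j \<le> (K + B) h\<^sup>q = Q K h\<^sup>q\<close> for \<open>h \<le> 1\<close>.\<close>
  define Q where "Q = 1 + B / K"
  have ev: "eventually (\<lambda>h::real. 0 < h \<and> h \<le> 1) (at_right 0)"
    unfolding eventually_at_right_field by (intro exI[of _ 1]) auto
  show ?thesis
  proof (rule bigoI[of _ "real p * Q ^ (2 * p) / K"], use c B(2) ev in eventually_elim)
    case (elim h)
    let ?e = "K * h powr q" and ?IS = "IS u x0 h (c h)"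
    let ?\<alpha> = "alpha u x0 K q p h (c h)"
    have e: "0 < ?e" using K elim by simp
    have "h\<^sup>2 = h powr 2" using elim by (simp add: powr_numeral)
    also have "\<dots> \<le> h powr q" using elim q by (intro powr_mono') auto
    finally have h2: "B * h\<^sup>2 \<le> B * h powr q" using B(1) by simp
    have upper: "?e + ?IS j \<le> Q * ?e" if "j < 3" for j
    proof -
      have "?IS j \<le> (\<Sum>j<3. ?IS j)"
        using that by (intro member_le_sum) (auto simp: IS_nonneg)
      also have "\<dots> \<le> B * h\<^sup>2" using elim by auto
      finally have "?e + ?IS j \<le> ?e + B * h powr q" using h2 by linarith
      then show ?thesis using K by (simp add: Q_def field_simps)
    qed
    have "\<bar>?\<alpha> i / sum ?\<alpha> {..<3} - c h i\<bar>
        \<le> real p * Q ^ (2 * p) * (c h i * (\<Sum>j\<in>{..<3}. c h j * \<bar>(?e + ?IS i) - (?e + ?IS j)\<bar>) / ?e)"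
    proof (rule normalised_weight_error)
      show "sum (c h) {..<3} = 1" using elim by (simp add: eval_nat_numeral)
    qed (use i elim e upper in \<open>auto simp: IS_nonneg alpha_def\<close>)
    moreover have "sum ?\<alpha> {..<3} = ?\<alpha> 0 + ?\<alpha> 1 + ?\<alpha> 2" by (simp add: eval_nat_numeral)
    moreover have "0 \<le> c h i * (\<Sum>j<3. c h j * \<bar>?IS i - ?IS j\<bar>) * h powr (- q)"
      using elim i by (intro mult_nonneg_nonneg sum_nonneg) (auto simp: less_imp_le)
    ultimately show ?case
      by (simp add: omega_def powr_minus divide_inverse mult_ac)
  qed
qed

theorem theorem3p1:
  shows "\<exists>k::nat. \<forall>(u::real \<Rightarrow> real) (x0::real) (K::real) (q::real) (p::nat)
            (K0::real) (K1::real) (\<gamma>0::real) (\<gamma>1::real).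
    (\<exists>h0>0. Ck_on k u {x0 .. x0 + 3 * h0}) \<longrightarrow>
    K > 0 \<longrightarrow> q > 0 \<longrightarrow> q \<le> 2 \<longrightarrow> p \<ge> 1 \<longrightarrow>
    K0 > 0 \<longrightarrow> K1 > 0 \<longrightarrow> \<gamma>0 \<ge> 0 \<longrightarrow> \<gamma>1 \<ge> 0 \<longrightarrow> \<gamma>0 \<ge> \<gamma>1 \<longrightarrow> \<gamma>0 \<ge> 1 \<longrightarrow>
    (\<forall>i<3. eventually (\<lambda>h. opt_weight K0 K1 \<gamma>0 \<gamma>1 h i > 0) (at_right 0)) \<longrightarrow>
    (let c = opt_weight K0 K1 \<gamma>0 \<gamma>1;
         \<omega> = (\<lambda>h. omega u x0 K q p h (c h));
         l = min \<gamma>0 (\<gamma>1 + 1)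
     in (\<lambda>h. \<omega> h 0 - c h 0) \<in> O[at_right 0](\<lambda>h. h powr (\<gamma>0 + 2 - q)) \<and>
        (\<lambda>h. \<omega> h 1 - c h 1) \<in> O[at_right 0](\<lambda>h. h powr (\<gamma>1 + 3 - q)) \<and>
        (\<lambda>h. \<omega> h 2 - c h 2) \<in> O[at_right 0](\<lambda>h. h powr (l + 2 - q)) \<and>
        (\<gamma>0 \<ge> q \<longrightarrow>
           (\<lambda>h. \<omega> h 0 - c h 0) \<in> O[at_right 0](\<lambda>h. h ^ 2) \<and>
           (\<lambda>h. \<omega> h 1 - c h 1) \<in> O[at_right 0](\<lambda>h. h) \<and>
           (\<lambda>h. \<omega> h 2 - c h 2) \<in> O[at_right 0](\<lambda>h. h)))"
proof (intro exI[of _ 2] allI impI, elim exE conjE)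
  fix u :: "real \<Rightarrow> real" and x0 K q K0 K1 \<gamma>0 \<gamma>1 h0 :: real and p :: nat
  assume h0: "0 < h0" "Ck_on 2 u {x0..x0 + 3 * h0}" and K: "0 < K" and q: "q \<le> 2"
    and K01: "0 < K0" "0 < K1" and \<gamma>: "0 \<le> \<gamma>1" "\<gamma>1 \<le> \<gamma>0" "1 \<le> \<gamma>0"
    and pos: "\<forall>i<3. eventually (\<lambda>h. 0 < opt_weight K0 K1 \<gamma>0 \<gamma>1 h i) (at_right 0)"
  define c where "c = opt_weight K0 K1 \<gamma>0 \<gamma>1"
  define \<omega> where "\<omega> = (\<lambda>h. omega u x0 K q p h (c h))"
  define l where "l = min \<gamma>0 (\<gamma>1 + 1)"
  let ?IS = "\<lambda>i h. IS u x0 h (c h) i"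
  have "eventually (\<lambda>h. 0 < opt_weight K0 K1 \<gamma>0 \<gamma>1 h 2) (at_right 0)" using pos by simp
  from opt_weight_2_bounded_below[OF \<gamma>(3,1) K01(1) this]
  obtain m where m: "0 < m" "eventually (\<lambda>h. m \<le> c h 2) (at_right 0)"
    unfolding c_def by blast
  have c: "eventually (\<lambda>h. (\<forall>i<3. 0 < c h i) \<and> c h 0 + c h 1 + c h 2 = 1) (at_right 0)"
  proof (intro eventually_conj)
    have "eventually (\<lambda>h. \<forall>i\<in>{..<3}. 0 < c h i) (at_right 0)"
      using pos by (intro eventually_ball_finite) (auto simp: c_def)
    then show "eventually (\<lambda>h. \<forall>i<3. 0 < c h i) (at_right 0)" by (rule eventually_mono) auto
  qed (simp add: c_def opt_weight_def)
  have c0: "(\<lambda>h. c h 0) \<in> O[at_right 0](\<lambda>h. h powr \<gamma>0)"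
    and c1: "(\<lambda>h. c h 1) \<in> O[at_right 0](\<lambda>h. h powr \<gamma>1)"
    by (simp_all add: c_def opt_weight_def)
  have c2: "(\<lambda>h. c h 2) \<in> O[at_right 0](\<lambda>h. h powr 0)"
  proof (rule bigoI[of _ 1], use c eventually_at_right_less[of "0::real"] in eventually_elim)
    case (elim h)
    then have "0 < h" "0 < c h 0" "0 < c h 1" "0 < c h 2" "c h 0 + c h 1 + c h 2 = 1" by auto
    then show ?case by auto
  qed
  have c0_h: "(\<lambda>h. c h 0) \<in> O[at_right 0](\<lambda>h. h powr 1)"
    by (rule landau_o.big_trans[OF c0 powr_bigo_powr_at_right_0[OF \<gamma>(3)]])
  have c1_1: "(\<lambda>h. c h 1) \<in> O[at_right 0](\<lambda>h. h powr 0)"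
    by (rule landau_o.big_trans[OF c1 powr_bigo_powr_at_right_0[OF \<gamma>(1)]])

  note IS = IS_bigo[OF sigma_asymptotics[OF h0]
      c0_h[folded landau_o.big.cong_bigtheta[OF id_bigtheta_powr_1]] c m]
  have IS1: "?IS 1 \<in> O[at_right 0](\<lambda>h. h powr 2)" and IS2: "?IS 2 \<in> O[at_right 0](\<lambda>h. h powr 2)"
    using IS(1,3) by (simp_all only: landau_o.big.cong_bigtheta[OF square_bigtheta_powr_2])
  have "(\<lambda>h::real. h ^ 3) \<in> \<Theta>[at_right 0](\<lambda>h. h powr 3)"
    by (intro bigthetaI_cong eventually_mono[OF eventually_at_right_less[of 0]]) (auto simp: powr_numeral)
  then have IS21: "(\<lambda>h. ?IS 2 h - ?IS 1 h) \<in> O[at_right 0](\<lambda>h. h powr 3)"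
    using IS(2) by (simp only: landau_o.big.cong_bigtheta)
  have IS0: "?IS 0 h = 0" for h by (simp add: IS_def)

  \<comment> \<open>An order \<open>a\<close> of \<open>c\<^sub>i\<close> and an order \<open>b\<close> of the averaged differences of the indicators add up.\<close>
  have reduce: "(\<lambda>h. \<omega> h i - c h i) \<in> O[at_right 0](\<lambda>h. h powr (a + b - q))"
    if "i < 3" "(\<lambda>h. c h i) \<in> O[at_right 0](\<lambda>h. h powr a)"
      "(\<lambda>h. \<Sum>j<3. c h j * \<bar>?IS i h - ?IS j h\<bar>) \<in> O[at_right 0](\<lambda>h. h powr b)" for i a b
  proof -
    have "?IS j \<in> O[at_right 0](\<lambda>h. h\<^sup>2)" if "j < 3" for j
    proof -
      have "j = 0 \<or> j = 1 \<or> j = 2" using that by auto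
      then show ?thesis using IS(1,3) by (auto simp: IS0)
    qed
    from omega_error_bigo[OF K q that(1) c this]
    have "(\<lambda>h. \<omega> h i - c h i)
      \<in> O[at_right 0](\<lambda>h. c h i * (\<Sum>j<3. c h j * \<bar>?IS i h - ?IS j h\<bar>) * h powr (- q))"
      unfolding \<omega>_def .
    also have "(\<lambda>h. c h i * (\<Sum>j<3. c h j * \<bar>?IS i h - ?IS j h\<bar>) * h powr (- q))
        \<in> O[at_right 0](\<lambda>h. h powr (a + b + - q))"
      using that by (intro bigo_powr_mult_at_right_0) auto
    finally show ?thesis by simp
  qed
  have sum3: "(\<Sum>j<3. f j) = f 0 + f 1 + f 2" for f :: "nat \<Rightarrow> real"
    by (simp add: eval_nat_numeral)
  have mult: "(\<lambda>h. f h * \<bar>g h\<bar>) \<in> O[at_right 0](\<lambda>h. h powr d)"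
    if "f \<in> O[at_right 0](\<lambda>h. h powr a)" "g \<in> O[at_right 0](\<lambda>h. h powr b)" "d \<le> a + b"
    for f g :: "real \<Rightarrow> real" and a b d
  proof (rule landau_o.big_trans[OF bigo_powr_mult_at_right_0[OF that(1)]])
    show "(\<lambda>h. \<bar>g h\<bar>) \<in> O[at_right 0](\<lambda>h. h powr b)" using that(2) by simp
  qed (rule powr_bigo_powr_at_right_0[OF that(3)])

  have \<omega>0: "(\<lambda>h. \<omega> h 0 - c h 0) \<in> O[at_right 0](\<lambda>h. h powr (\<gamma>0 + 2 - q))"
    using sum_in_bigo(1)[OF mult[OF c1_1 IS1] mult[OF c2 IS2], of 2]
    by (intro reduce c0) (simp_all add: sum3 IS0)
  have \<omega>1: "(\<lambda>h. \<omega> h 1 - c h 1) \<in> O[at_right 0](\<lambda>h. h powr (\<gamma>1 + 3 - q))"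
    using sum_in_bigo(1)[OF mult[OF c0_h IS1] mult[OF c2 IS21], of 3]
    by (intro reduce c1) (simp_all add: sum3 IS0 abs_minus_commute)
  \<comment> \<open>Only \<open>c\<^sub>2 = O(1)\<close> is available here; the decay comes from \<open>c\<^sub>0\<close> and \<open>c\<^sub>1\<close> inside the sum.\<close>
  have "(\<lambda>h. \<omega> h 2 - c h 2) \<in> O[at_right 0](\<lambda>h. h powr (0 + (l + 2) - q))"
    using sum_in_bigo(1)[OF mult[OF c0 IS2] mult[OF c1 IS21], of "l + 2"]
    by (intro reduce c2) (simp_all add: sum3 IS0 l_def)
  then have \<omega>2: "(\<lambda>h. \<omega> h 2 - c h 2) \<in> O[at_right 0](\<lambda>h. h powr (l + 2 - q))" by simp

  \<comment> \<open>If \<open>q \<le> \<gamma>\<^sub>0\<close>, the three exponents are at least 2, 1 and 1, the last two because \<open>3 - q \<ge> 1\<close>.\<close>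
  have "(\<lambda>h. \<omega> h 0 - c h 0) \<in> O[at_right 0](\<lambda>h. h ^ 2) \<and>
      (\<lambda>h. \<omega> h 1 - c h 1) \<in> O[at_right 0](\<lambda>h. h) \<and>
      (\<lambda>h. \<omega> h 2 - c h 2) \<in> O[at_right 0](\<lambda>h. h)" if "q \<le> \<gamma>0"
    unfolding landau_o.big.cong_bigtheta[OF square_bigtheta_powr_2]
      landau_o.big.cong_bigtheta[OF id_bigtheta_powr_1]
    using that \<gamma> q
    by (intro conjI landau_o.big_trans[OF \<omega>0 powr_bigo_powr_at_right_0]
        landau_o.big_trans[OF \<omega>1 powr_bigo_powr_at_right_0]
        landau_o.big_trans[OF \<omega>2 powr_bigo_powr_at_right_0]) (auto simp: l_def)
  with \<omega>0 \<omega>1 \<omega>2 show "let c = opt_weight K0 K1 \<gamma>0 \<gamma>1;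
         \<omega> = (\<lambda>h. omega u x0 K q p h (c h));
         l = min \<gamma>0 (\<gamma>1 + 1)
     in (\<lambda>h. \<omega> h 0 - c h 0) \<in> O[at_right 0](\<lambda>h. h powr (\<gamma>0 + 2 - q)) \<and>
        (\<lambda>h. \<omega> h 1 - c h 1) \<in> O[at_right 0](\<lambda>h. h powr (\<gamma>1 + 3 - q)) \<and>
        (\<lambda>h. \<omega> h 2 - c h 2) \<in> O[at_right 0](\<lambda>h. h powr (l + 2 - q)) \<and>
        (\<gamma>0 \<ge> q \<longrightarrow>
           (\<lambda>h. \<omega> h 0 - c h 0) \<in> O[at_right 0](\<lambda>h. h ^ 2) \<and>
           (\<lambda>h. \<omega> h 1 - c h 1) \<in> O[at_right 0](\<lambda>h. h) \<and>
           (\<lambda>h. \<omega> h 2 - c h 2) \<in> O[at_right 0](\<lambda>h. h))"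
    unfolding Let_def \<omega>_def l_def c_def by blast
qed

end
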